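(* Let $a,b,c$ be positive integers with $a\le b$. Suppose that every $n\in\mathbb{N}=\{0,1,2,\ldots\}$ can be written as $n=ax^2+by^2+ct_z$ with $x,y,z\in\mathbb{Z}$, where $t_z=z(z+1)/2$. Then $(a,b,c)$ is among the following vectors: $$(1,1,1),\ (1,1,2),\ (1,2,1),\ (1,2,2),\ (1,2,4),\ (1,3,1),\ (1,4,1),\ (1,4,2),\ (1,8,1),\ (2,2,1).$$
   Context: $\mathbb{N}=\{0,1,2,\ldots\}$, and $t_z=z(z+1)/2$ for $z\in\mathbb{Z}$ denotes a triangular number. *)

theory Defs
  imports Main
begin

definition triangular :: "int \<Rightarrow> int" where
  "triangular z = z * (z + 1) div 2"

text \<open>The integer division in the definition is exact.\<close>

lemma two_times_triangular: "2 * triangular z = z * (z + 1)"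
  by (simp add: triangular_def)

end

theory Submission
  imports Defs
begin

text \<open>
  The argument is an escalation. A term whose coefficient exceeds \<open>n\<close> must vanish in any
  representation of \<open>n\<close>. Hence, if some of the three terms cannot represent \<open>n\<close> by themselves, one
  of the other coefficients is at most \<open>n\<close>. The number 1 forces \<open>a = 1\<close> or \<open>c = 1\<close>.

  If \<open>a = 1\<close>, the number 2 forces \<open>b \<le> 2\<close> or \<open>c \<le> 2\<close>. The numbers 3, 5, 8 and 5 are missed by
  \<open>x\<^sup>2 + y\<^sup>2\<close>, \<open>x\<^sup>2 + 2y\<^sup>2\<close>, \<open>x\<^sup>2 + t\<^sub>z\<close> and \<open>x\<^sup>2 + 2t\<^sub>z\<close> respectively, and so they bound the remaining
  coefficient. If \<open>a \<ge> 2\<close> and \<open>c = 1\<close>, the number 2 forces \<open>a = 2\<close>, and then 4, which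
  \<open>2x\<^sup>2 + t\<^sub>z\<close> misses, forces \<open>b \<le> 4\<close>.

  This leaves twenty vectors. Ten are those of the theorem, and each of the others misses an explicit
  number, the largest being 47 for \<open>(1,6,1)\<close>. Every miss is a finite computation, because \<open>x\<close>, \<open>y\<close>
  and \<open>z\<close> are bounded in a representation of a given number (lemma \<open>represents_bounded\<close>).
\<close>

definition represents :: "int \<Rightarrow> int \<Rightarrow> int \<Rightarrow> int \<Rightarrow> bool" where
  "represents a b c n \<longleftrightarrow> (\<exists>x y z. n = a * x\<^sup>2 + b * y\<^sup>2 + c * triangular z)"

definition universal :: "int \<Rightarrow> int \<Rightarrow> int \<Rightarrow> bool" where
  "universal a b c \<longleftrightarrow> (\<forall>n\<ge>0. represents a b c n)"

text \<open>
  Lists of integers and plain products make this predicate directly computable. The range of \<open>z\<close>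
  is twice as long because \<open>t\<^sub>z\<close> grows only like \<open>z\<^sup>2 / 2\<close>.
\<close>

definition represents_below :: "int \<Rightarrow> int \<Rightarrow> int \<Rightarrow> int \<Rightarrow> int \<Rightarrow> bool" where
  "represents_below s a b c n \<longleftrightarrow>
     (\<exists>x\<in>set [0..s - 1]. \<exists>y\<in>set [0..s - 1]. \<exists>z\<in>set [0..2 * s - 1].
        n = a * (x * x) + b * (y * y) + c * (z * (z + 1) div 2))"

definition truncate_above :: "int \<Rightarrow> int \<Rightarrow> int" where
  "truncate_above n a = (if a \<le> n then a else 0)"

lemma triangular_nonneg: "0 \<le> triangular z"
proof -
  have "0 \<le> z * (z + 1)"
    by (cases "0 \<le> z") (auto intro: mult_nonpos_nonpos)
  then show ?thesis
    using two_times_triangular[of z] by linarith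
qed

text \<open>The reflection \<open>z \<mapsto> -1 - z\<close> fixes triangular numbers, so non-negative arguments suffice.\<close>

lemma triangular_nonneg_argument: "\<exists>w\<ge>0. triangular z = triangular w"
proof (cases "0 \<le> z")
  case False
  have "(-1 - z) * (-1 - z + 1) = z * (z + 1)"
    by (simp add: algebra_simps)
  then have "triangular z = triangular (-1 - z)"
    by (simp only: triangular_def)
  then show ?thesis
    using False by (intro exI[of _ "-1 - z"]) auto
qed auto

lemma square_term_bounded:
  fixes a n s x :: int
  assumes "0 < a" "0 < s" "n < s\<^sup>2" "a * x\<^sup>2 \<le> n"
  shows "\<exists>u. 0 \<le> u \<and> u < s \<and> a * x\<^sup>2 = truncate_above n a * (u * u)"
proof (cases "a \<le> n")
  case True
  have "x\<^sup>2 \<le> a * x\<^sup>2"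
    using assms(1) mult_right_mono[of 1 a "x\<^sup>2"] by simp
  then have "\<bar>x\<bar>\<^sup>2 < s\<^sup>2"
    using assms by simp
  then have "\<bar>x\<bar> < s"
    using assms(2) power_less_imp_less_base by fastforce
  then show ?thesis
    using True by (intro exI[of _ "\<bar>x\<bar>"]) (auto simp: truncate_above_def power2_eq_square)
next
  case False
  have "x = 0"
  proof (rule ccontr)
    assume "x \<noteq> 0"
    then have "1 \<le> x\<^sup>2"
      using zero_less_power2[of x] by linarith
    then have "a * 1 \<le> a * x\<^sup>2"
      using assms(1) by (intro mult_left_mono) auto
    then show False
      using False assms(4) by linarith
  qed
  then show ?thesis
    using assms(2) False by (intro exI[of _ 0]) (simp add: truncate_above_def)
qed

text \<open>The bound \<open>2s\<close> comes from \<open>z\<^sup>2 \<le> 2t\<^sub>z \<le> 2n < 2s\<^sup>2\<close>.\<close>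

lemma triangular_term_bounded:
  fixes c n s z :: int
  assumes "0 < c" "0 < s" "n < s\<^sup>2" "c * triangular z \<le> n"
  shows "\<exists>w. 0 \<le> w \<and> w < 2 * s \<and>
    c * triangular z = truncate_above n c * (w * (w + 1) div 2)"
proof (cases "c \<le> n")
  case True
  obtain w where w: "0 \<le> w" "triangular z = triangular w"
    using triangular_nonneg_argument by blast
  have "triangular w \<le> c * triangular w"
    using assms(1) mult_right_mono[of 1 c "triangular w"] triangular_nonneg by simp
  then have "w\<^sup>2 < 2 * s\<^sup>2"
    using assms(3,4) w two_times_triangular[of w] by (simp add: power2_eq_square algebra_simps)
  also have "\<dots> \<le> (2 * s)\<^sup>2"
    by (simp add: power2_eq_square)
  finally have "w < 2 * s"
    using assms(2) power_less_imp_less_base[of w 2 "2 * s"] by simp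
  then show ?thesis
    using True w by (intro exI[of _ w]) (simp add: truncate_above_def triangular_def)
next
  case False
  have "triangular z = 0"
  proof (rule ccontr)
    assume "triangular z \<noteq> 0"
    then have "1 \<le> triangular z"
      using triangular_nonneg[of z] by linarith
    then have "c * 1 \<le> c * triangular z"
      using assms(1) by (intro mult_left_mono) auto
    then show False
      using False assms(4) by linarith
  qed
  then show ?thesis
    using assms(2) False by (intro exI[of _ 0]) (simp add: truncate_above_def)
qed

text \<open>
  Coefficients above \<open>n\<close> become 0, so the conclusion no longer mentions them. This turns a statement
  about all large coefficients into a finite search with numerals.
\<close>

lemma represents_bounded:
  assumes "represents a b c n" "0 < a" "0 < b" "0 < c" "0 < s" "n < s\<^sup>2"
  shows "represents_below s (truncate_above n a) (truncate_above n b) (truncate_above n c) n"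
proof -
  obtain x y z where n: "n = a * x\<^sup>2 + b * y\<^sup>2 + c * triangular z"
    using assms(1) unfolding represents_def by blast
  have "0 \<le> a * x\<^sup>2" "0 \<le> b * y\<^sup>2" "0 \<le> c * triangular z"
    using assms(2-4) triangular_nonneg[of z] by simp_all
  then have bounded: "a * x\<^sup>2 \<le> n" "b * y\<^sup>2 \<le> n" "c * triangular z \<le> n"
    using n by linarith+
  obtain u where u: "0 \<le> u" "u < s" "a * x\<^sup>2 = truncate_above n a * (u * u)"
    using square_term_bounded[OF assms(2,5,6) bounded(1)] by blast
  obtain v where v: "0 \<le> v" "v < s" "b * y\<^sup>2 = truncate_above n b * (v * v)"
    using square_term_bounded[OF assms(3,5,6) bounded(2)] by blast
  obtain w where w: "0 \<le> w" "w < 2 * s"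
      "c * triangular z = truncate_above n c * (w * (w + 1) div 2)"
    using triangular_term_bounded[OF assms(4,5,6) bounded(3)] by blast
  have "n = truncate_above n a * (u * u) + truncate_above n b * (v * v)
      + truncate_above n c * (w * (w + 1) div 2)"
    using n unfolding u(3) v(3) w(3) .
  moreover have "u \<in> set [0..s - 1]" "v \<in> set [0..s - 1]" "w \<in> set [0..2 * s - 1]"
    using u(1,2) v(1,2) w(1,2) by simp_all
  ultimately show ?thesis
    unfolding represents_below_def by blast
qed

lemma universal_bounded:
  assumes "universal a b c" "0 < a" "0 < b" "0 < c" "0 \<le> n" "0 < s" "n < s\<^sup>2"
  shows "represents_below s (truncate_above n a) (truncate_above n b) (truncate_above n c) n"
  using assms represents_bounded unfolding universal_def by blast

text \<open>A zero coefficient below stands for every coefficient larger than the number missed.\<close>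

lemma missed_by_partial_forms:
  "\<not> represents_below 2 0 0 0 1"
  "\<not> represents_below 2 1 0 0 2"
  "\<not> represents_below 2 0 0 1 2"
  "\<not> represents_below 2 1 1 0 3"
  "\<not> represents_below 3 1 2 0 5"
  "\<not> represents_below 3 1 0 1 8"
  "\<not> represents_below 3 1 0 2 5"
  "\<not> represents_below 3 2 0 1 4"
  by code_simp+

lemma missed_by_ternary_forms:
  "\<not> represents_below 3 1 1 3 6"
  "\<not> represents_below 5 1 2 3 23"
  "\<not> represents_below 4 1 2 5 10"
  "\<not> represents_below 4 1 5 1 13"
  "\<not> represents_below 7 1 6 1 47"
  "\<not> represents_below 5 1 7 1 20"
  "\<not> represents_below 3 1 3 2 8"
  "\<not> represents_below 5 1 5 2 19"
  "\<not> represents_below 3 2 3 1 7"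
  "\<not> represents_below 5 2 4 1 20"
  by code_simp+

lemma not_universal:
  "\<not> universal 1 1 3" "\<not> universal 1 2 3" "\<not> universal 1 2 5" "\<not> universal 1 5 1"
  "\<not> universal 1 6 1" "\<not> universal 1 7 1" "\<not> universal 1 3 2" "\<not> universal 1 5 2"
  "\<not> universal 2 3 1" "\<not> universal 2 4 1"
  using missed_by_ternary_forms
    universal_bounded[of 1 1 3 6 3] universal_bounded[of 1 2 3 23 5]
    universal_bounded[of 1 2 5 10 4] universal_bounded[of 1 5 1 13 4]
    universal_bounded[of 1 6 1 47 7] universal_bounded[of 1 7 1 20 5]
    universal_bounded[of 1 3 2 8 3] universal_bounded[of 1 5 2 19 5]
    universal_bounded[of 2 3 1 7 3] universal_bounded[of 2 4 1 20 5]
  by (auto simp: truncate_above_def)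

lemma universal_leading_one:
  assumes "universal 1 b c" "0 < b" "0 < c"
  shows "(b, c) \<in> {(1,1), (1,2), (2,1), (2,2), (2,4), (3,1), (4,1), (4,2), (8,1)}"
proof -
  have "b \<le> 2 \<or> c \<le> 2"
    using universal_bounded[of 1 b c 2 2] assms missed_by_partial_forms(2)
    by (auto simp: truncate_above_def split: if_splits)
  then consider "b = 1" | "b = 2" | "c = 1" | "c = 2"
    using assms(2,3) by linarith
  then show ?thesis
  proof cases
    case 1
    have "c \<le> 3"
      using universal_bounded[of 1 1 c 3 2] assms 1 missed_by_partial_forms(4)
      by (auto simp: truncate_above_def split: if_splits)
    then consider "c = 1" | "c = 2" | "c = 3"
      using assms(3) by linarith
    then show ?thesis
      using 1 assms(1) not_universal by cases auto
  next
    case 2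
    have "c \<le> 5"
      using universal_bounded[of 1 2 c 5 3] assms 2 missed_by_partial_forms(5)
      by (auto simp: truncate_above_def split: if_splits)
    then consider "c = 1" | "c = 2" | "c = 3" | "c = 4" | "c = 5"
      using assms(3) by linarith
    then show ?thesis
      using 2 assms(1) not_universal by cases auto
  next
    case 3
    have "b \<le> 8"
      using universal_bounded[of 1 b 1 8 3] assms 3 missed_by_partial_forms(6)
      by (auto simp: truncate_above_def split: if_splits)
    then consider "b = 1" | "b = 2" | "b = 3" | "b = 4" | "b = 5" | "b = 6" | "b = 7" | "b = 8"
      using assms(2) by linarith
    then show ?thesis
      using 3 assms(1) not_universal by cases auto
  next
    case 4
    have "b \<le> 5"
      using universal_bounded[of 1 b 2 5 3] assms 4 missed_by_partial_forms(7)
      by (auto simp: truncate_above_def split: if_splits)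
    then consider "b = 1" | "b = 2" | "b = 3" | "b = 4" | "b = 5"
      using assms(2) by linarith
    then show ?thesis
      using 4 assms(1) not_universal by cases auto
  qed
qed

lemma universal_leading_larger:
  assumes "universal a b c" "2 \<le> a" "a \<le> b" "0 < c"
  shows "(a, b, c) = (2, 2, 1)"
proof -
  have "c \<le> 1"
    using universal_bounded[of a b c 1 2] assms missed_by_partial_forms(1)
    by (auto simp: truncate_above_def split: if_splits)
  then have c: "c = 1"
    using assms(4) by linarith
  have "a \<le> 2"
    using universal_bounded[of a b 1 2 2] assms c missed_by_partial_forms(3)
    by (auto simp: truncate_above_def split: if_splits)
  then have a: "a = 2"
    using assms(2) by linarith
  have "b \<le> 4"
    using universal_bounded[of 2 b 1 4 3] assms a c missed_by_partial_forms(8)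
    by (auto simp: truncate_above_def split: if_splits)
  then consider "b = 2" | "b = 3" | "b = 4"
    using assms(3) a by linarith
  then show ?thesis
    using a c assms(1) not_universal by cases auto
qed

theorem theorem2:
  fixes a b c :: int
  assumes "a > 0" and "b > 0" and "c > 0" and "a \<le> b"
    and "\<And>n :: nat. \<exists>x y z :: int. int n = a * x\<^sup>2 + b * y\<^sup>2 + c * triangular z"
  shows "(a, b, c) \<in> {(1,1,1), (1,1,2), (1,2,1), (1,2,2), (1,2,4),
                       (1,3,1), (1,4,1), (1,4,2), (1,8,1), (2,2,1)}"
proof -
  have "represents a b c n" if "0 \<le> n" for n
    using assms(5)[of "nat n"] that unfolding represents_def by simp
  then have universal: "universal a b c"
    unfolding universal_def by blast
  show ?thesis
  proof (cases "a = 1")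
    case True
    then show ?thesis
      using universal_leading_one[of b c] universal assms(2,3) by auto
  next
    case False
    then have "(a, b, c) = (2, 2, 1)"
      using universal_leading_larger[of a b c] universal assms(1,3,4) by linarith
    then show ?thesis
      by simp
  qed
qed

end
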